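(* Let $[X,\mathcal{B},m,\nu]$ be a reversible random walk space and let $\Omega\in\mathcal{B}$ be $m$-connected with $0<\nu(\Omega)<\nu(\Omega_m)<\infty$, and assume $\Omega$ satisfies a $2$-Poincaré inequality. Assume that $\lambda_{m,2}(\Omega)$ is an eigenvalue of the $m$-Laplacian with homogeneous Dirichlet boundary conditions. Then: 1. $g_{m,\Omega}(n)>0$ for all $n\in\mathbb{N}$. 2. Assume moreover that there exists an eigenfunction $f$ associated to $\lambda_{m,2}(\Omega)$ such that $\alpha\le f\le\widetilde\alpha$ in $\Omega$ for some constants $\alpha,\widetilde\alpha>0$. Then $$\lambda_{m,2}(\Omega)=1-\lim_{n\to\infty}\sqrt[n]{\frac{g_{m,\Omega}(2n)}{g_{m,\Omega}(n)}}.$$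
   Context: A random walk $m$ on a measurable space $(X,\mathcal{B})$ ($\mathcal{B}$ countably generated) is a family $(m_x)_{x\in X}$ of probability measures on $\mathcal{B}$ such that $x\mapsto m_x(B)$ is measurable for each $B\in\mathcal{B}$. A $\sigma$-finite measure $\nu$ on $X$ is reversible if $dm_x(y)d\nu(x)=dm_y(x)d\nu(y)$ as measures on $X\times X$; then $[X,\mathcal{B},m,\nu]$ is called a reversible random walk space. For $A,B\in\mathcal{B}$, $L_m(A,B):=\int_A m_x(B)\,d\nu(x)$. For $\Omega\in\mathcal{B}$: $\partial_m\Omega:=\{x\in X\setminus\Omega: m_x(\Omega)>0\}$ and $\Omega_m:=\Omega\cup\partial_m\Omega$. A set $\Omega\in\mathcal B$ with $\nu(\Omega)>0$ is $m$-connected if $L_m(A,B)>0$ for all measurable $A,B\subset\Omega$ of positive $\nu$-measure with $A\cup B=\Omega$. $\Omega$ satisfies a $2$-Poincaré inequality if there is $\lambda>0$ with $\lambda\int_\Omega|f|^2d\nu\le\int_{\Omega_m}\int_{\Omega_m}|f(y)-f(x)|^2dm_x(y)d\nu(x)$ for all $f\in L^2(\Omega_m,\nu)$ with $f=0$ $\nu$-a.e. on $\partial_m\Omega$. Define $$\lambda_{m,2}(\Omega):=\inf\left\{\frac{\frac12\int_{\Omega_m}\int_{\Omega_m}|g(y)-g(x)|^2dm_x(y)d\nu(x)}{\int_\Omega g^2d\nu}: g\in L^2(\Omega_m,\nu)\setminus\{0\},\ g=0\text{ on }\partial_m\Omega\right\}.$$ We say that $\lambda_{m,2}(\Omega)$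 is an eigenvalue of the $m$-Laplacian with homogeneous Dirichlet boundary conditions if there is a non-null $f\in L^2(\Omega_m,\nu)$ (called an associated eigenfunction) such that $-\int_{\Omega_m}(f(y)-f(x))\,dm_x(y)=\lambda_{m,2}(\Omega)f(x)$ for ($\nu$-a.e.) $x\in\Omega$ and $f(x)=0$ for $x\in\partial_m\Omega$. $g_{m,\Omega}(0):=\nu(\Omega)$ and, for $n\ge1$, $$g_{m,\Omega}(n):=\int_{\Omega^{n+1}}dm_{x_n}(x_{n+1})\cdots dm_{x_1}(x_2)\,d\nu(x_1).$$ $\mathbb{N}=\{1,2,\dots\}$. *)

theory Defs
  imports "HOL-Probability.Probability"
begin

text \<open>A measurable space \<open>(X, \<B>)\<close> is represented by a measure \<open>M\<close> of which only
  \<open>space M\<close> and \<open>sets M\<close> are used.  Measurability into \<open>prob_algebra M\<close> says that every \<open>m x\<close>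
  is a probability measure on \<open>sets M\<close> and that \<open>x \<mapsto> m x B\<close> is measurable for every
  \<open>B \<in> sets M\<close>.\<close>

locale random_walk =
  fixes M :: "'a measure" and m :: "'a \<Rightarrow> 'a measure"
  assumes countably_generated:
      "\<exists>G. countable G \<and> G \<subseteq> Pow (space M) \<and> sets M = sigma_sets (space M) G"
    and kernel: "m \<in> M \<rightarrow>\<^sub>M prob_algebra M"

text \<open>In \<open>reversible\<close>, the two sides are the values at \<open>C\<close> of the measures
  \<open>dm\<^sub>x(y) d\<nu>(x)\<close> and \<open>dm\<^sub>y(x) d\<nu>(y)\<close> on \<open>X \<times> X\<close>.\<close>

locale reversible_random_walk_space = random_walk M m + sigma_finite_measure \<nu>
  for M :: "'a measure" and m :: "'a \<Rightarrow> 'a measure" and \<nu> :: "'a measure" +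
  assumes sets_nu: "sets \<nu> = sets M"
    and reversible: "\<And>C. C \<in> sets (M \<Otimes>\<^sub>M M) \<Longrightarrow>
      (\<integral>\<^sup>+x. (\<integral>\<^sup>+y. indicator C (x, y) \<partial>m x) \<partial>\<nu>) =
      (\<integral>\<^sup>+y. (\<integral>\<^sup>+x. indicator C (x, y) \<partial>m y) \<partial>\<nu>)"

definition m_interaction :: "('a \<Rightarrow> 'a measure) \<Rightarrow> 'a measure \<Rightarrow> 'a set \<Rightarrow> 'a set \<Rightarrow> ennreal" where
  "m_interaction m \<nu> A B = (\<integral>\<^sup>+x\<in>A. emeasure (m x) B \<partial>\<nu>)"

definition m_boundary :: "('a \<Rightarrow> 'a measure) \<Rightarrow> 'a measure \<Rightarrow> 'a set \<Rightarrow> 'a set" where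
  "m_boundary m \<nu> \<Omega> = {x \<in> space \<nu> - \<Omega>. emeasure (m x) \<Omega> > 0}"

definition m_closure :: "('a \<Rightarrow> 'a measure) \<Rightarrow> 'a measure \<Rightarrow> 'a set \<Rightarrow> 'a set" where
  "m_closure m \<nu> \<Omega> = \<Omega> \<union> m_boundary m \<nu> \<Omega>"

definition m_connected :: "('a \<Rightarrow> 'a measure) \<Rightarrow> 'a measure \<Rightarrow> 'a set \<Rightarrow> bool" where
  "m_connected m \<nu> \<Omega> \<longleftrightarrow> \<Omega> \<in> sets \<nu> \<and> emeasure \<nu> \<Omega> > 0 \<and>
    (\<forall>A\<in>sets \<nu>. \<forall>B\<in>sets \<nu>. A \<subseteq> \<Omega> \<longrightarrow> B \<subseteq> \<Omega> \<longrightarrow> emeasure \<nu> A > 0 \<longrightarrow> emeasure \<nu> B > 0 \<longrightarrow>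
      A \<union> B = \<Omega> \<longrightarrow> m_interaction m \<nu> A B > 0)"

text \<open>Elements of \<open>L\<^sup>2(A, \<nu>)\<close> are represented by functions whose values outside \<open>A\<close> are
  irrelevant.  Accordingly, equalities and bounds between them are required \<open>\<nu>\<close>-almost everywhere.\<close>

definition L2_on :: "'a measure \<Rightarrow> 'a set \<Rightarrow> ('a \<Rightarrow> real) set" where
  "L2_on \<nu> A = {f. f \<in> borel_measurable (restrict_space \<nu> A) \<and>
    integrable (restrict_space \<nu> A) (\<lambda>x. (f x)\<^sup>2)}"

definition L2_Dirichlet :: "('a \<Rightarrow> 'a measure) \<Rightarrow> 'a measure \<Rightarrow> 'a set \<Rightarrow> ('a \<Rightarrow> real) set" where
  "L2_Dirichlet m \<nu> \<Omega> = {f \<in> L2_on \<nu> (m_closure m \<nu> \<Omega>).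
    AE x in \<nu>. x \<in> m_boundary m \<nu> \<Omega> \<longrightarrow> f x = 0}"

definition nonnull_on :: "'a measure \<Rightarrow> 'a set \<Rightarrow> ('a \<Rightarrow> real) \<Rightarrow> bool" where
  "nonnull_on \<nu> A f \<longleftrightarrow> \<not> (AE x in \<nu>. x \<in> A \<longrightarrow> f x = 0)"

definition m_energy :: "('a \<Rightarrow> 'a measure) \<Rightarrow> 'a measure \<Rightarrow> 'a set \<Rightarrow> ('a \<Rightarrow> real) \<Rightarrow> ennreal" where
  "m_energy m \<nu> A f = (\<integral>\<^sup>+x\<in>A. (\<integral>\<^sup>+y\<in>A. ennreal (\<bar>f y - f x\<bar>\<^sup>2) \<partial>m x) \<partial>\<nu>)"

definition Poincare_2 :: "('a \<Rightarrow> 'a measure) \<Rightarrow> 'a measure \<Rightarrow> 'a set \<Rightarrow> bool" where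
  "Poincare_2 m \<nu> \<Omega> \<longleftrightarrow> (\<exists>c::real. c > 0 \<and> (\<forall>f\<in>L2_Dirichlet m \<nu> \<Omega>.
    ennreal c * (\<integral>\<^sup>+x\<in>\<Omega>. ennreal (\<bar>f x\<bar>\<^sup>2) \<partial>\<nu>) \<le> m_energy m \<nu> (m_closure m \<nu> \<Omega>) f))"

text \<open>For every competitor \<open>g\<close> in the infimum, numerator and denominator are finite and the
  denominator is nonzero; the infimum itself is finite as soon as \<open>0 < \<nu>(\<Omega>) < \<infinity>\<close>.\<close>

definition lambda_m2 :: "('a \<Rightarrow> 'a measure) \<Rightarrow> 'a measure \<Rightarrow> 'a set \<Rightarrow> real" where
  "lambda_m2 m \<nu> \<Omega> = enn2real
    (INF g \<in> {g \<in> L2_Dirichlet m \<nu> \<Omega>. nonnull_on \<nu> (m_closure m \<nu> \<Omega>) g}.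
      (1/2 * m_energy m \<nu> (m_closure m \<nu> \<Omega>) g) / (\<integral>\<^sup>+x\<in>\<Omega>. ennreal ((g x)\<^sup>2) \<partial>\<nu>))"

text \<open>For \<open>f \<in> L\<^sup>2(\<Omega>\<^sub>m, \<nu>)\<close> the integrand below is \<open>m x\<close>-integrable for \<open>\<nu>\<close>-almost every
  \<open>x \<in> \<Omega>\<close>, by reversibility.\<close>

definition Dirichlet_eigenfunction ::
  "('a \<Rightarrow> 'a measure) \<Rightarrow> 'a measure \<Rightarrow> 'a set \<Rightarrow> real \<Rightarrow> ('a \<Rightarrow> real) \<Rightarrow> bool" where
  "Dirichlet_eigenfunction m \<nu> \<Omega> \<mu> f \<longleftrightarrow>
    f \<in> L2_Dirichlet m \<nu> \<Omega> \<and> nonnull_on \<nu> (m_closure m \<nu> \<Omega>) f \<and>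
    (AE x in \<nu>. x \<in> \<Omega> \<longrightarrow>
      - set_lebesgue_integral (m x) (m_closure m \<nu> \<Omega>) (\<lambda>y. f y - f x) = \<mu> * f x)"

definition Dirichlet_eigenvalue ::
  "('a \<Rightarrow> 'a measure) \<Rightarrow> 'a measure \<Rightarrow> 'a set \<Rightarrow> real \<Rightarrow> bool" where
  "Dirichlet_eigenvalue m \<nu> \<Omega> \<mu> \<longleftrightarrow> (\<exists>f. Dirichlet_eigenfunction m \<nu> \<Omega> \<mu> f)"

text \<open>\<open>stay m \<Omega> n x\<^sub>1\<close> is the integral of \<open>dm\<^bsub>x\<^sub>n\<^esub>(x\<^sub>n\<^sub>+\<^sub>1) \<dots> dm\<^bsub>x\<^sub>1\<^esub>(x\<^sub>2)\<close> over
  \<open>(x\<^sub>2, \<dots>, x\<^sub>n\<^sub>+\<^sub>1) \<in> \<Omega>\<^sup>n\<close>.\<close>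

primrec stay :: "('a \<Rightarrow> 'a measure) \<Rightarrow> 'a set \<Rightarrow> nat \<Rightarrow> 'a \<Rightarrow> ennreal" where
  "stay m \<Omega> 0 x = 1"
| "stay m \<Omega> (Suc n) x = (\<integral>\<^sup>+y\<in>\<Omega>. stay m \<Omega> n y \<partial>m x)"

text \<open>The integral is at most \<open>\<nu>(\<Omega>)\<close>, hence finite when \<open>\<nu>(\<Omega>) < \<infinity>\<close>.\<close>

definition g_m :: "('a \<Rightarrow> 'a measure) \<Rightarrow> 'a measure \<Rightarrow> 'a set \<Rightarrow> nat \<Rightarrow> real" where
  "g_m m \<nu> \<Omega> n = enn2real (\<integral>\<^sup>+x\<in>\<Omega>. stay m \<Omega> n x \<partial>\<nu>)"

end

theory Submission
  imports Defs
begin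

text \<open>Write \<open>T u (x) = \<integral>\<^sub>\<Omega> u dm\<^sub>x\<close>, so that \<open>g\<^sub>m\<^sub>,\<^sub>\<Omega>(n) = \<integral>\<^sub>\<Omega> T\<^sup>n 1 d\<nu>\<close>.  Reversibility makes \<open>\<nu>\<close>-null sets
  \<open>m\<^sub>x\<close>-null for almost every \<open>x\<close>, so \<open>T\<close> is a positive operator on almost everywhere classes.
  Connectedness applied to the pair \<open>{x \<in> \<Omega>. T 1 x = 0}, \<Omega>\<close> (which need not be disjoint) gives
  \<open>T 1 > 0\<close>, hence \<open>T\<^sup>n 1 > 0\<close>, almost everywhere on \<open>\<Omega>\<close>.  A Dirichlet eigenfunction
  satisfies \<open>T f = (1 - \<lambda>) f\<close>, because \<open>m\<^sub>x\<close> lives on \<open>\<Omega>\<^sub>m\<close> for almost every \<open>x \<in> \<Omega>\<close>.  If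
  \<open>\<alpha> \<le> f \<le> \<alpha>'\<close>, iterating gives \<open>\<alpha> T\<^sup>n 1 \<le> (1 - \<lambda>)\<^sup>n f \<le> \<alpha>' T\<^sup>n 1\<close>; integrated over \<open>\<Omega>\<close>, this
  says that \<open>g\<^sub>m\<^sub>,\<^sub>\<Omega>(n)\<close> is comparable to \<open>(1 - \<lambda>)\<^sup>n\<close>.\<close>

section \<open>Roots of ratios for a sequence comparable to a geometric one\<close>

lemma root_ratio_tendsto:
  fixes g :: "nat \<Rightarrow> real"
  assumes "q > 0" "a > 0" "b > 0"
    and lower: "\<And>n. a * q ^ n \<le> g n" and upper: "\<And>n. g n \<le> b * q ^ n"
  shows "(\<lambda>n. root n (g (2 * n) / g n)) \<longlonglongrightarrow> q"
proof (rule tendsto_sandwich)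
  have g_pos: "g n > 0" for n
    using lower[of n] assms(1,2) by (smt (verit) mult_pos_pos zero_less_power)
  have q2: "q ^ (2 * n) = q ^ n * q ^ n" for n
    by (simp add: mult_2 power_add)
  \<comment> \<open>Positivity of \<open>n\<close> matters: \<open>root 0\<close> is the zero
    function, so it does not invert a power.\<close>
  have root_mult_q: "root n (c * q ^ n) = root n c * q" if "n > 0" for n c
    using that \<open>q > 0\<close> by (simp add: real_root_mult real_root_power_cancel)
  \<comment> \<open>The lower bound at \<open>2 * n\<close> against the upper bound at
    \<open>n\<close> leaves one factor \<open>q ^ n\<close> and the constant \<open>a / b\<close>;
    \<open>ub\<close> is the mirror image. The roots of both constants tend to 1.\<close>
  have lb: "a / b * q ^ n \<le> g (2 * n) / g n" for n
  proof -
    have "a / b * q ^ n * g n \<le> a / b * q ^ n * (b * q ^ n)"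
      using assms upper[of n] by (intro mult_left_mono) auto
    also have "\<dots> = a * q ^ (2 * n)"
      using assms by (simp add: q2)
    also have "\<dots> \<le> g (2 * n)" by (rule lower)
    finally show ?thesis using g_pos[of n] by (simp add: pos_le_divide_eq)
  qed
  have ub: "g (2 * n) / g n \<le> b / a * q ^ n" for n
  proof -
    have "g (2 * n) \<le> b * q ^ (2 * n)" by (rule upper)
    also have "\<dots> = b / a * q ^ n * (a * q ^ n)"
      using assms by (simp add: q2)
    also have "\<dots> \<le> b / a * q ^ n * g n"
      using assms lower[of n] by (intro mult_left_mono) auto
    finally show ?thesis using g_pos[of n] by (simp add: pos_divide_le_eq)
  qed
  show "\<forall>\<^sub>F n in sequentially. root n (a / b) * q \<le> root n (g (2 * n) / g n)"
    using eventually_gt_at_top[of 0]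
    by eventually_elim (metis lb real_root_le_mono root_mult_q)
  show "\<forall>\<^sub>F n in sequentially. root n (g (2 * n) / g n) \<le> root n (b / a) * q"
    using eventually_gt_at_top[of 0]
    by eventually_elim (metis ub real_root_le_mono root_mult_q)
  show "(\<lambda>n. root n (a / b) * q) \<longlonglongrightarrow> q" "(\<lambda>n. root n (b / a) * q) \<longlonglongrightarrow> q"
    using tendsto_mult[OF LIMSEQ_root_const tendsto_const, of "a / b" q]
      tendsto_mult[OF LIMSEQ_root_const tendsto_const, of "b / a" q] assms
    by auto
qed

section \<open>The kernel and the functions \<open>stay\<close>\<close>

context random_walk
begin

lemma prob_space_kernel: "x \<in> space M \<Longrightarrow> prob_space (m x)"
  and sets_kernel: "x \<in> space M \<Longrightarrow> sets (m x) = sets M"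
  using measurable_space[OF kernel] by (auto simp: space_prob_algebra)

lemma space_kernel: "x \<in> space M \<Longrightarrow> space (m x) = space M"
  by (rule sets_eq_imp_space_eq[OF sets_kernel])

lemma measurable_nn_integral_kernel:
  assumes "f \<in> borel_measurable M"
  shows "(\<lambda>x. \<integral>\<^sup>+y. f y \<partial>m x) \<in> borel_measurable M"
  by (rule measurable_compose[OF measurable_prob_algebraD[OF kernel]
        nn_integral_measurable_subprob_algebra[OF assms]])

lemma measurable_emeasure_kernel:
  assumes "A \<in> sets M"
  shows "(\<lambda>x. emeasure (m x) A) \<in> borel_measurable M"
  by (rule measurable_compose[OF measurable_prob_algebraD[OF kernel]
        measurable_emeasure_subprob_algebra[OF assms]])

lemma measurable_stay:
  assumes "\<Omega> \<in> sets M"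
  shows "stay m \<Omega> n \<in> borel_measurable M"
proof (induction n)
  case 0
  have "stay m \<Omega> 0 = (\<lambda>x. 1)" by (rule ext) simp
  then show ?case by simp
next
  case (Suc n)
  have "stay m \<Omega> (Suc n) = (\<lambda>x. \<integral>\<^sup>+y. stay m \<Omega> n y * indicator \<Omega> y \<partial>m x)"
    by (rule ext) simp
  then show ?case
    using Suc assms by (auto intro!: measurable_nn_integral_kernel)
qed

lemma stay_le_1:
  assumes "x \<in> space M"
  shows "stay m \<Omega> n x \<le> 1"
  using assms
proof (induction n arbitrary: x)
  case (Suc n)
  have "stay m \<Omega> (Suc n) x \<le> (\<integral>\<^sup>+y. 1 \<partial>m x)"
    unfolding stay.simps
    by (intro nn_integral_mono) (use Suc space_kernel in \<open>auto simp: indicator_def\<close>)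
  also have "\<dots> = 1"
    using prob_space_kernel[OF Suc.prems] by (simp add: prob_space.emeasure_space_1)
  finally show ?case .
qed simp

end

section \<open>Consequences of reversibility\<close>

context reversible_random_walk_space
begin

lemma space_nu: "space \<nu> = space M"
  by (rule sets_eq_imp_space_eq[OF sets_nu])

lemma measurable_nu_iff: "borel_measurable \<nu> = borel_measurable M"
  by (rule measurable_cong_sets[OF sets_nu refl])

text \<open>Reversibility, tested on the rectangle \<open>A \<times> B\<close>.\<close>

lemma interaction_commute:
  assumes [measurable]: "A \<in> sets M" "B \<in> sets M"
  shows "m_interaction m \<nu> A B = m_interaction m \<nu> B A"
proof -
  have eq: "(\<integral>\<^sup>+y. indicator (C \<times> D) (x, y) \<partial>m x) = emeasure (m x) D * indicator C x"
    "(\<integral>\<^sup>+y. indicator (D \<times> C) (y, x) \<partial>m x) = emeasure (m x) D * indicator C x"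
    if "x \<in> space \<nu>" "D \<in> sets M" for C D x
    using that sets_kernel[of x]
    by (simp_all add: indicator_times space_nu nn_integral_cmult_indicator
        nn_integral_multc mult.commute)
  have "m_interaction m \<nu> A B = (\<integral>\<^sup>+x. (\<integral>\<^sup>+y. indicator (A \<times> B) (x, y) \<partial>m x) \<partial>\<nu>)"
    unfolding m_interaction_def by (intro nn_integral_cong) (simp add: eq)
  also have "\<dots> = (\<integral>\<^sup>+y. (\<integral>\<^sup>+x. indicator (A \<times> B) (x, y) \<partial>m y) \<partial>\<nu>)"
    by (rule reversible) simp
  also have "\<dots> = m_interaction m \<nu> B A"
    unfolding m_interaction_def by (intro nn_integral_cong) (simp add: eq)
  finally show ?thesis .
qed

text \<open>For a \<nu>-null set \<open>N\<close>, symmetry turns the integral of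
  \<open>emeasure (m x) N\<close> into an integral over \<open>N\<close>, which is 0. This is what
  allows almost everywhere statements to be carried through one step of the walk in the inductions
  below.\<close>

lemma AE_kernel:
  assumes "AE y in \<nu>. P y"
  shows "AE x in \<nu>. AE y in m x. P y"
proof -
  obtain N where N: "{y \<in> space \<nu>. \<not> P y} \<subseteq> N" "emeasure \<nu> N = 0" "N \<in> sets \<nu>"
    using AE_E[OF assms] by blast
  have [measurable]: "N \<in> sets M" using N sets_nu by simp
  have "(\<integral>\<^sup>+x. emeasure (m x) N \<partial>\<nu>) = m_interaction m \<nu> (space M) N"
    unfolding m_interaction_def by (intro nn_integral_cong) (simp add: space_nu)
  also have "\<dots> = m_interaction m \<nu> N (space M)"
    by (rule interaction_commute) auto
  also have "\<dots> = 0"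
    unfolding m_interaction_def using N by (intro nn_integral_null_set) auto
  finally have "AE x in \<nu>. emeasure (m x) N = 0"
    by (subst (asm) nn_integral_0_iff_AE)
      (auto simp: measurable_nu_iff intro!: measurable_emeasure_kernel)
  then show ?thesis
    using AE_space
  proof eventually_elim
    case (elim x)
    then show ?case
      using N(1) sets_kernel[of x] space_kernel[of x]
      by (intro AE_I[of _ _ N]) (auto simp: space_nu)
  qed
qed

lemma sets_m_closure:
  assumes [measurable]: "\<Omega> \<in> sets M"
  shows "m_closure m \<nu> \<Omega> \<in> sets M"
proof -
  note measurable_emeasure_kernel[measurable]
  have "m_boundary m \<nu> \<Omega> = {x \<in> space M. emeasure (m x) \<Omega> > 0} - \<Omega>"
    by (auto simp: m_boundary_def space_nu)
  also have "\<dots> \<in> sets M" by measurable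
  finally show ?thesis by (simp add: m_closure_def)
qed

text \<open>Points outside the closure do not jump into \<Omega>, by definition of the boundary; by
  symmetry, almost no point of \<Omega> jumps out of the closure.\<close>

lemma AE_kernel_closure:
  assumes [measurable]: "\<Omega> \<in> sets M"
  shows "AE x in \<nu>. x \<in> \<Omega> \<longrightarrow> (AE y in m x. y \<in> m_closure m \<nu> \<Omega>)"
proof -
  define D where "D = space M - m_closure m \<nu> \<Omega>"
  have D [measurable]: "D \<in> sets M"
    unfolding D_def using sets_m_closure by auto
  have "m_interaction m \<nu> \<Omega> D = m_interaction m \<nu> D \<Omega>"
    by (rule interaction_commute) auto
  also have "\<dots> = (\<integral>\<^sup>+x. 0 \<partial>\<nu>)"
    unfolding m_interaction_def
    by (intro nn_integral_cong)
      (auto simp: D_def m_closure_def m_boundary_def space_nu indicator_def)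
  finally have "m_interaction m \<nu> \<Omega> D = 0" by simp
  then have "AE x in \<nu>. emeasure (m x) D * indicator \<Omega> x = 0"
    unfolding m_interaction_def
    by (subst (asm) nn_integral_0_iff_AE)
      (auto simp: measurable_nu_iff intro!: borel_measurable_times_ennreal
        measurable_emeasure_kernel)
  then show ?thesis
    using AE_space
  proof eventually_elim
    case (elim x)
    then show ?case
      using D sets_kernel[of x] space_kernel[of x]
      by (auto simp: D_def space_nu intro!: AE_I[of _ _ D])
  qed
qed

section \<open>Positivity from connectedness\<close>

lemma connected_emeasure_pos:
  assumes [measurable]: "\<Omega> \<in> sets M" and conn: "m_connected m \<nu> \<Omega>"
  shows "AE x in \<nu>. x \<in> \<Omega> \<longrightarrow> emeasure (m x) \<Omega> \<noteq> 0"
proof -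
  note measurable_emeasure_kernel[measurable]
  define Z where "Z = {x \<in> space M. emeasure (m x) \<Omega> = 0} \<inter> \<Omega>"
  have Z: "Z \<in> sets M" unfolding Z_def by measurable
  have "m_interaction m \<nu> Z \<Omega> = (\<integral>\<^sup>+x. 0 \<partial>\<nu>)"
    unfolding m_interaction_def
    by (intro nn_integral_cong) (auto simp: Z_def indicator_def)
  then have "\<not> emeasure \<nu> Z > 0"
    using conn Z unfolding m_connected_def sets_nu
    by (metis Un_absorb1 Z_def inf_le2 less_irrefl nn_integral_const mult_zero_left subset_refl)
  then have "Z \<in> null_sets \<nu>" using Z by (auto simp: sets_nu)
  then show ?thesis
    by (rule AE_mp[OF AE_not_in]) (auto simp: Z_def space_nu)
qed

text \<open>If the integral defining \<open>stay m \<Omega> (Suc n) x\<close> vanishes while its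
  integrand is nonzero at \<open>m x\<close>-almost every point of \<Omega>, then \<Omega> is
  \<open>m x\<close>-null, which happens for almost no \<open>x\<close> in \<Omega>.\<close>

lemma stay_pos:
  assumes [measurable]: "\<Omega> \<in> sets M" and conn: "m_connected m \<nu> \<Omega>"
  shows "AE x in \<nu>. x \<in> \<Omega> \<longrightarrow> stay m \<Omega> n x \<noteq> 0"
proof (induction n)
  case (Suc n)
  show ?case
    using AE_kernel[OF Suc] connected_emeasure_pos[OF assms] AE_space
  proof eventually_elim
    case (elim x)
    have x: "x \<in> space M" using elim by (simp add: space_nu)
    have [measurable_cong]: "sets (m x) = sets M" by (rule sets_kernel[OF x])
    note measurable_stay[measurable]
    show ?case
    proof (intro impI notI)
      assume "x \<in> \<Omega>" "stay m \<Omega> (Suc n) x = 0"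
      then have "AE y in m x. stay m \<Omega> n y * indicator \<Omega> y = 0"
        by (simp add: nn_integral_0_iff_AE)
      then have "AE y in m x. y \<notin> \<Omega>"
        using elim(1) by eventually_elim (auto simp: indicator_def split: if_splits)
      then have "emeasure (m x) \<Omega> = 0"
        by (subst (asm) AE_iff_measurable[of \<Omega>])
          (use sets.sets_into_space[OF assms(1)] space_kernel[OF x] in auto)
      with elim \<open>x \<in> \<Omega>\<close> show False by simp
    qed
  qed
qed simp

text \<open>The bound \<open>stay_le_1\<close> keeps the integral finite, so \<open>enn2real\<close>
  loses nothing here; an infinite value would have been sent to 0.\<close>

lemma ennreal_g_m:
  assumes [measurable]: "\<Omega> \<in> sets M" and fin: "emeasure \<nu> \<Omega> < \<infinity>"
  shows "ennreal (g_m m \<nu> \<Omega> n) = (\<integral>\<^sup>+x\<in>\<Omega>. stay m \<Omega> n x \<partial>\<nu>)"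
proof -
  have "(\<integral>\<^sup>+x\<in>\<Omega>. stay m \<Omega> n x \<partial>\<nu>) \<le> (\<integral>\<^sup>+x. indicator \<Omega> x \<partial>\<nu>)"
    using stay_le_1 by (intro nn_integral_mono) (auto simp: indicator_def space_nu)
  also have "\<dots> < \<infinity>"
    using fin by (simp add: sets_nu)
  finally show ?thesis by (simp add: g_m_def)
qed

lemma nn_set_integral_pos:
  assumes [measurable]: "\<Omega> \<in> sets M" "f \<in> borel_measurable M"
    and pos: "emeasure \<nu> \<Omega> > 0" and f: "AE x in \<nu>. x \<in> \<Omega> \<longrightarrow> f x \<noteq> 0"
  shows "(\<integral>\<^sup>+x\<in>\<Omega>. f x \<partial>\<nu>) > 0"
proof (rule ccontr)
  note [measurable_cong] = sets_nu
  assume "\<not> ?thesis"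
  then have "AE x in \<nu>. f x * indicator \<Omega> x = 0"
    by (simp add: nn_integral_0_iff_AE)
  with f have "AE x in \<nu>. x \<notin> \<Omega>"
    by eventually_elim (auto simp: indicator_def split: if_splits)
  then have "emeasure \<nu> \<Omega> = 0"
    by (subst (asm) AE_iff_measurable[of \<Omega>])
      (use sets.sets_into_space[OF assms(1)] in \<open>auto simp: sets_nu space_nu\<close>)
  with pos show False by simp
qed

lemma g_m_pos:
  assumes "\<Omega> \<in> sets M" "m_connected m \<nu> \<Omega>" "emeasure \<nu> \<Omega> < \<infinity>"
  shows "g_m m \<nu> \<Omega> n > 0"
proof -
  have "ennreal (g_m m \<nu> \<Omega> n) > 0"
    unfolding ennreal_g_m[OF assms(1,3)] using assms
    by (intro nn_set_integral_pos measurable_stay stay_pos) (auto simp: m_connected_def)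
  then show ?thesis by simp
qed

section \<open>Eigenfunctions and the limit\<close>

lemma measurable_L2_Dirichlet:
  assumes \<Omega>: "\<Omega> \<in> sets M" and f: "f \<in> L2_Dirichlet m \<nu> \<Omega>"
  shows "(\<lambda>x. indicator (m_closure m \<nu> \<Omega>) x * f x) \<in> borel_measurable M"
    and "(\<lambda>x. indicator \<Omega> x * f x) \<in> borel_measurable M"
proof -
  define C where "C = m_closure m \<nu> \<Omega>"
  have C: "C \<in> sets M" unfolding C_def by (rule sets_m_closure[OF \<Omega>])
  have "f \<in> borel_measurable (restrict_space \<nu> C)"
    using f by (simp add: L2_Dirichlet_def L2_on_def C_def)
  then have fC: "(\<lambda>x. indicator C x * f x) \<in> borel_measurable M"
    using C sets.sets_into_space[OF C]
    by (subst (asm) borel_measurable_restrict_space_iff)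
      (auto simp: measurable_nu_iff space_nu sets_nu Int_absorb2)
  then show "(\<lambda>x. indicator (m_closure m \<nu> \<Omega>) x * f x) \<in> borel_measurable M"
    by (simp add: C_def)
  from fC have "(\<lambda>x. indicator \<Omega> x * (indicator C x * f x)) \<in> borel_measurable M"
    by (rule borel_measurable_times[OF borel_measurable_indicator[OF \<Omega>]])
  also have "(\<lambda>x. indicator \<Omega> x * (indicator C x * f x)) = (\<lambda>x. indicator \<Omega> x * f x)"
    by (auto simp: fun_eq_iff C_def m_closure_def indicator_def)
  finally show "(\<lambda>x. indicator \<Omega> x * f x) \<in> borel_measurable M" .
qed

text \<open>The integral over the closure reduces to the integral of \<open>f\<close> over \<Omega>
  minus \<open>f x\<close>, since \<open>m x\<close> lives on the closure, has mass 1, and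
  \<open>f\<close> vanishes on the boundary. The sign of \<open>(1 - \<mu>) * f x\<close> is
  recorded separately because \<open>ennreal\<close> truncates negative reals to 0.\<close>

lemma eigenfunction_nn_integral:
  assumes \<Omega>: "\<Omega> \<in> sets M" and eig: "Dirichlet_eigenfunction m \<nu> \<Omega> \<mu> f"
    and bounds: "AE x in \<nu>. x \<in> \<Omega> \<longrightarrow> 0 \<le> f x \<and> f x \<le> b"
  shows "AE x in \<nu>. x \<in> \<Omega> \<longrightarrow>
    0 \<le> (1 - \<mu>) * f x \<and> (\<integral>\<^sup>+y\<in>\<Omega>. ennreal (f y) \<partial>m x) = ennreal ((1 - \<mu>) * f x)"
proof -
  define F where "F x = indicator \<Omega> x * f x" for x
  have Dir: "f \<in> L2_Dirichlet m \<nu> \<Omega>"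
    and eq: "AE x in \<nu>. x \<in> \<Omega> \<longrightarrow>
      - set_lebesgue_integral (m x) (m_closure m \<nu> \<Omega>) (\<lambda>y. f y - f x) = \<mu> * f x"
    using eig by (auto simp: Dirichlet_eigenfunction_def)
  have F [measurable]: "F \<in> borel_measurable M"
    unfolding F_def using measurable_L2_Dirichlet(2)[OF \<Omega> Dir] .
  note closure_measurable [measurable] = measurable_L2_Dirichlet(1)[OF \<Omega> Dir]
  have "AE x in \<nu>. x \<in> m_boundary m \<nu> \<Omega> \<longrightarrow> f x = 0"
    using Dir by (simp add: L2_Dirichlet_def)
  from AE_kernel[OF this] AE_kernel[OF bounds] AE_kernel_closure[OF \<Omega>] eq AE_space
  show ?thesis
  proof eventually_elim
    case (elim x)
    have x: "x \<in> space M" using elim by (simp add: space_nu)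
    have [measurable_cong]: "sets (m x) = sets M" by (rule sets_kernel[OF x])
    interpret P: prob_space "m x" by (rule prob_space_kernel[OF x])
    show ?case
    proof
      assume "x \<in> \<Omega>"
      have F_bounds: "AE y in m x. 0 \<le> F y \<and> norm (F y) \<le> \<bar>b\<bar>"
        using elim(2) by eventually_elim (auto simp: F_def indicator_def)
      \<comment> \<open>Boundedness on a probability space gives integrability, needed to split the
        Lebesgue integral and to identify it with the nonnegative one.\<close>
      have int: "integrable (m x) F"
        by (rule P.integrable_const_bound[of _ "\<bar>b\<bar>"])
          (use F_bounds in \<open>auto elim: eventually_mono\<close>)
      have "AE y in m x. y \<in> m_closure m \<nu> \<Omega>" using elim(3) \<open>x \<in> \<Omega>\<close> by simp
      with elim(1) have AE_eq:
        "AE y in m x. indicator (m_closure m \<nu> \<Omega>) y *\<^sub>R (f y - f x) = F y - f x"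
        by eventually_elim (auto simp: F_def m_closure_def indicator_def m_boundary_def)
      have "set_lebesgue_integral (m x) (m_closure m \<nu> \<Omega>) (\<lambda>y. f y - f x)
          = (\<integral>y. F y - f x \<partial>m x)"
        unfolding set_lebesgue_integral_def
      proof (rule integral_cong_AE)
        \<comment> \<open>Nothing is known about \<open>f\<close> outside the closure; expanding the
          product leaves \<open>f\<close> only multiplied by the indicator, which is
          measurable.\<close>
        show "(\<lambda>y. indicator (m_closure m \<nu> \<Omega>) y *\<^sub>R (f y - f x)) \<in> borel_measurable (m x)"
          using closure_measurable sets_m_closure[OF \<Omega>]
          by (simp add: right_diff_distrib)
      qed (use AE_eq in auto)
      also have "\<dots> = (\<integral>y. F y \<partial>m x) - f x"
        using int by (simp add: P.prob_space)
      finally have F_int: "(\<integral>y. F y \<partial>m x) = (1 - \<mu>) * f x"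
        using elim(4) \<open>x \<in> \<Omega>\<close> by (simp add: algebra_simps)
      have "(\<integral>\<^sup>+y\<in>\<Omega>. ennreal (f y) \<partial>m x) = (\<integral>\<^sup>+y. ennreal (F y) \<partial>m x)"
        by (intro nn_integral_cong) (auto simp: F_def indicator_def)
      also have "\<dots> = ennreal (\<integral>y. F y \<partial>m x)"
        using F_bounds by (intro nn_integral_eq_integral int) (auto elim: eventually_mono)
      finally have "(\<integral>\<^sup>+y\<in>\<Omega>. ennreal (f y) \<partial>m x) = ennreal ((1 - \<mu>) * f x)"
        by (simp add: F_int)
      moreover have "(\<integral>y. F y \<partial>m x) \<ge> 0"
        using F_bounds by (intro integral_nonneg_AE) (auto elim: eventually_mono)
      ultimately show "0 \<le> (1 - \<mu>) * f x \<and>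
          (\<integral>\<^sup>+y\<in>\<Omega>. ennreal (f y) \<partial>m x) = ennreal ((1 - \<mu>) * f x)"
        by (simp add: F_int)
    qed
  qed
qed

text \<open>Integrating the bounds for \<open>n\<close> over \<Omega> against \<open>m x\<close>
  raises the index of \<open>stay\<close> by one and, by \<open>T\<close>, multiplies the middle
  term by \<open>q\<close>. With values in \<open>ennreal\<close>, no integrability has to be
  carried along.\<close>

lemma stay_bounds:
  assumes \<Omega> [measurable]: "\<Omega> \<in> sets M" and f [measurable]: "f \<in> borel_measurable M"
    and T: "AE x in \<nu>. x \<in> \<Omega> \<longrightarrow> (\<integral>\<^sup>+y\<in>\<Omega>. f y \<partial>m x) = q * f x"
    and bounds: "AE x in \<nu>. x \<in> \<Omega> \<longrightarrow> a \<le> f x \<and> f x \<le> b"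
  shows "AE x in \<nu>. x \<in> \<Omega> \<longrightarrow>
    a * stay m \<Omega> n x \<le> q ^ n * f x \<and> q ^ n * f x \<le> b * stay m \<Omega> n x"
proof (induction n)
  case 0
  then show ?case using bounds by simp
next
  case (Suc n)
  show ?case
    using AE_kernel[OF Suc] T AE_space
  proof eventually_elim
    case (elim x)
    have x: "x \<in> space M" using elim by (simp add: space_nu)
    have [measurable_cong]: "sets (m x) = sets M" by (rule sets_kernel[OF x])
    note measurable_stay[OF \<Omega>, measurable]
    have stay_Suc: "c * stay m \<Omega> (Suc n) x = (\<integral>\<^sup>+y\<in>\<Omega>. c * stay m \<Omega> n y \<partial>m x)" for c
      by (simp add: nn_integral_cmult[symmetric] mult.assoc)
    show ?case
    proof
      assume "x \<in> \<Omega>"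
      then have "q ^ Suc n * f x = q ^ n * (\<integral>\<^sup>+y\<in>\<Omega>. f y \<partial>m x)"
        using elim(2) by (simp add: mult_ac)
      also have "\<dots> = (\<integral>\<^sup>+y\<in>\<Omega>. q ^ n * f y \<partial>m x)"
        by (simp add: nn_integral_cmult[symmetric] mult.assoc)
      finally have eq: "q ^ Suc n * f x = (\<integral>\<^sup>+y\<in>\<Omega>. q ^ n * f y \<partial>m x)" .
      show "a * stay m \<Omega> (Suc n) x \<le> q ^ Suc n * f x \<and>
          q ^ Suc n * f x \<le> b * stay m \<Omega> (Suc n) x"
        unfolding eq stay_Suc using elim(1)
        by (intro conjI nn_integral_mono_AE)
          (auto elim!: eventually_mono simp: indicator_def)
    qed
  qed
qed

lemma g_m_ratio_root_tendsto:
  assumes \<Omega> [measurable]: "\<Omega> \<in> sets M" and conn: "m_connected m \<nu> \<Omega>"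
    and fin: "emeasure \<nu> \<Omega> < \<infinity>"
    and eig: "Dirichlet_eigenfunction m \<nu> \<Omega> \<mu> f" and "a > 0" "b > 0"
    and bounds: "AE x in \<nu>. x \<in> \<Omega> \<longrightarrow> a \<le> f x \<and> f x \<le> b"
  shows "(\<lambda>n. root n (g_m m \<nu> \<Omega> (2 * n) / g_m m \<nu> \<Omega> n)) \<longlonglongrightarrow> 1 - \<mu>"
proof -
  note [measurable_cong] = sets_nu
  note measurable_stay[OF \<Omega>, measurable]
  define q where "q = 1 - \<mu>"
  define F where "F x = ennreal (indicator \<Omega> x * f x)" for x
  define I where "I = (\<integral>\<^sup>+x\<in>\<Omega>. F x \<partial>\<nu>)"
  have \<Omega>_pos: "emeasure \<nu> \<Omega> > 0" using conn by (simp add: m_connected_def)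
  have F [measurable]: "F \<in> borel_measurable M"
    unfolding F_def using measurable_L2_Dirichlet(2)[OF \<Omega>] eig
    by (auto simp: Dirichlet_eigenfunction_def)
  have Tf: "AE x in \<nu>. x \<in> \<Omega> \<longrightarrow>
      0 \<le> q * f x \<and> (\<integral>\<^sup>+y\<in>\<Omega>. ennreal (f y) \<partial>m x) = ennreal (q * f x)"
    unfolding q_def using bounds \<open>a > 0\<close>
    by (intro eigenfunction_nn_integral[OF \<Omega> eig, of b]) (auto elim!: eventually_mono)
  have "q \<ge> 0"
  proof (rule ccontr)
    assume "\<not> q \<ge> 0"
    \<comment> \<open>For negative \<open>q\<close> the hypotheses contradict each other at almost
      every point of \<Omega>. The absurd conclusion is phrased as the constant 0 being nonzero
      there, so that positivity of the integral of 0 over \<Omega> refutes it.\<close>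
    from Tf bounds have "AE x in \<nu>. x \<in> \<Omega> \<longrightarrow> (0 :: ennreal) \<noteq> 0"
    proof eventually_elim
      case (elim x)
      then show ?case using \<open>a > 0\<close> \<open>\<not> q \<ge> 0\<close> by (auto simp: zero_le_mult_iff)
    qed
    from nn_set_integral_pos[OF \<Omega> _ \<Omega>_pos this] show False by simp
  qed
  have F_eq: "(\<integral>\<^sup>+y\<in>\<Omega>. F y \<partial>m x) = (\<integral>\<^sup>+y\<in>\<Omega>. ennreal (f y) \<partial>m x)" for x
    by (intro nn_integral_cong) (auto simp: F_def indicator_def)
  have TF: "AE x in \<nu>. x \<in> \<Omega> \<longrightarrow> (\<integral>\<^sup>+y\<in>\<Omega>. F y \<partial>m x) = ennreal q * F x"
    using Tf unfolding F_eq
    by eventually_elim (use \<open>q \<ge> 0\<close> in \<open>auto simp: F_def ennreal_mult'\<close>)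
  have F_bounds: "AE x in \<nu>. x \<in> \<Omega> \<longrightarrow> ennreal a \<le> F x \<and> F x \<le> ennreal b"
    using bounds by eventually_elim (auto simp: F_def intro: ennreal_leI)
  \<comment> \<open>The pointwise bounds of \<open>stay_bounds\<close>, integrated over \<Omega>;
    \<open>I\<close> is the integral of the eigenfunction.\<close>
  have sandwich: "ennreal a * ennreal (g_m m \<nu> \<Omega> n) \<le> ennreal q ^ n * I"
    "ennreal q ^ n * I \<le> ennreal b * ennreal (g_m m \<nu> \<Omega> n)" for n
    unfolding ennreal_g_m[OF \<Omega> fin] I_def using stay_bounds[OF \<Omega> F TF F_bounds, of n]
    by (auto simp: nn_integral_cmult[symmetric] mult.assoc[symmetric] indicator_def
        intro!: nn_integral_mono_AE elim!: eventually_mono)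
  have "I > 0"
    unfolding I_def using \<open>a > 0\<close>
    by (intro nn_set_integral_pos[OF \<Omega> F \<Omega>_pos] eventually_mono[OF F_bounds])
      (auto simp: ennreal_eq_0_iff)
  \<comment> \<open>At \<open>n = 0\<close> the upper half of the sandwich bounds \<open>I\<close>
    by a multiple of the finite number \<open>g_m m \<nu> \<Omega> 0\<close>.\<close>
  moreover have "I < \<infinity>"
    using sandwich(2)[of 0] by (auto simp: ennreal_mult_less_top intro: le_less_trans)
  ultimately obtain i where i: "I = ennreal i" "i > 0"
    by (cases I) auto
  have lower: "i / b * q ^ n \<le> g_m m \<nu> \<Omega> n" for n
  proof -
    have "q ^ n * i \<le> b * g_m m \<nu> \<Omega> n"
      using sandwich(2)[of n] g_m_pos[OF \<Omega> conn fin, of n] \<open>q \<ge> 0\<close> \<open>b > 0\<close> i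
      by (simp add: ennreal_power ennreal_mult[symmetric])
    then show ?thesis using \<open>b > 0\<close> by (simp add: field_simps)
  qed
  have upper: "g_m m \<nu> \<Omega> n \<le> i / a * q ^ n" for n
  proof -
    have "a * g_m m \<nu> \<Omega> n \<le> q ^ n * i"
      using sandwich(1)[of n] g_m_pos[OF \<Omega> conn fin, of n] \<open>q \<ge> 0\<close> \<open>a > 0\<close> i
      by (simp add: ennreal_power ennreal_mult[symmetric])
    then show ?thesis using \<open>a > 0\<close> by (simp add: field_simps)
  qed
  \<comment> \<open>Index 1 is the first one that sees \<open>q\<close>: if \<open>q\<close> were 0,
    the upper bound would force the positive number \<open>g_m m \<nu> \<Omega> 1\<close> to be at
    most 0.\<close>
  have "q \<noteq> 0" using upper[of 1] g_m_pos[OF \<Omega> conn fin, of 1] by auto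
  then show ?thesis
    unfolding q_def[symmetric] using \<open>q \<ge> 0\<close> i \<open>a > 0\<close> \<open>b > 0\<close>
    by (intro root_ratio_tendsto[OF _ _ _ lower upper]) auto
qed

end

theorem theorem3p10:
  fixes M :: "'a measure" and m :: "'a \<Rightarrow> 'a measure" and \<nu> :: "'a measure" and \<Omega> :: "'a set"
  assumes "reversible_random_walk_space M m \<nu>"
    and "\<Omega> \<in> sets M"
    and "m_connected m \<nu> \<Omega>"
    and "0 < emeasure \<nu> \<Omega>"
    and "emeasure \<nu> \<Omega> < emeasure \<nu> (m_closure m \<nu> \<Omega>)"
    and "emeasure \<nu> (m_closure m \<nu> \<Omega>) < \<infinity>"
    and "Poincare_2 m \<nu> \<Omega>"
    and "Dirichlet_eigenvalue m \<nu> \<Omega> (lambda_m2 m \<nu> \<Omega>)"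
  shows "(\<forall>n\<ge>1. g_m m \<nu> \<Omega> n > 0) \<and>
    ((\<exists>f \<alpha> \<alpha>'. Dirichlet_eigenfunction m \<nu> \<Omega> (lambda_m2 m \<nu> \<Omega>) f \<and> \<alpha> > 0 \<and> \<alpha>' > 0 \<and>
        (AE x in \<nu>. x \<in> \<Omega> \<longrightarrow> \<alpha> \<le> f x \<and> f x \<le> \<alpha>')) \<longrightarrow>
      convergent (\<lambda>n. root n (g_m m \<nu> \<Omega> (2 * n) / g_m m \<nu> \<Omega> n)) \<and>
      lambda_m2 m \<nu> \<Omega> = 1 - lim (\<lambda>n. root n (g_m m \<nu> \<Omega> (2 * n) / g_m m \<nu> \<Omega> n)))"
proof -
  interpret reversible_random_walk_space M m \<nu> by fact
  have fin: "emeasure \<nu> \<Omega> < \<infinity>" using assms(5,6) by (rule less_trans)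
  show ?thesis
  proof (intro conjI allI impI; (elim exE conjE)?)
    fix n :: nat
    show "g_m m \<nu> \<Omega> n > 0" by (rule g_m_pos[OF assms(2,3) fin])
  next
    fix f a b
    assume "Dirichlet_eigenfunction m \<nu> \<Omega> (lambda_m2 m \<nu> \<Omega>) f" "a > 0" "b > 0"
      "AE x in \<nu>. x \<in> \<Omega> \<longrightarrow> a \<le> f x \<and> f x \<le> b"
    \<comment> \<open>This limit yields both claims; convergence is shown explicitly because
      \<open>lim\<close> also denotes some value for divergent sequences.\<close>
    note lim = g_m_ratio_root_tendsto[OF assms(2,3) fin this]
    show "convergent (\<lambda>n. root n (g_m m \<nu> \<Omega> (2 * n) / g_m m \<nu> \<Omega> n))"
      by (rule convergentI[OF lim])
    show "lambda_m2 m \<nu> \<Omega> = 1 - lim (\<lambda>n. root n (g_m m \<nu> \<Omega> (2 * n) / g_m m \<nu> \<Omega> n))"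
      using limI[OF lim] by simp
  qed
qed

end
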